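(* Let $a, b, w, z$ be integers with $a\le b$. The number of $b$-tuples of non-negative integers that sum up to at most $w$ and for which the first $a$ entries are strictly smaller than $z$ equals $$\sum_{i=0}^{a} (-1)^i\binom{a}{i}\binom{w-iz+b}{b}.$$
   Context: Binomial coefficients $\binom{c}{b}$ with integers $c$ and $b\ge 0$ are the combinatorial ones: $\binom{c}{b}=0$ whenever $c<b$, including all negative $c$.
   Formalization: The formal statement assumes z ≥ 0 unless a = 0 (and a, b ≥ 0), since for negative z the claim fails: a = b = 1, w = 0, z = −1 gives count 0 but sum −1. *)

theory Defs
  imports Complex_Main
begin

text \<open>Combinatorial binomial coefficient with an integer upper argument: it vanishes for every
  \<open>c < b\<close>, in particular for negative \<open>c\<close> (also when \<open>b = 0\<close>).  This differs from \<open>c gchoose b\<close>,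
  which is the polynomial extension and is nonzero at negative integers.\<close>

definition binom :: "int \<Rightarrow> nat \<Rightarrow> int" where
  "binom c b = (if c < int b then 0 else int (nat c choose b))"

text \<open>The \<open>b\<close>-tuples are lists of length \<open>b\<close>, indexed from 0.\<close>

definition bounded_tuples :: "nat \<Rightarrow> nat \<Rightarrow> int \<Rightarrow> int \<Rightarrow> nat list set" where
  "bounded_tuples a b w z =
     {xs. length xs = b \<and> int (sum_list xs) \<le> w \<and> (\<forall>j<a. int (xs ! j) < z)}"

text \<open>Finiteness ensures that \<open>card (bounded_tuples a b w z)\<close> is a genuine count.\<close>

lemma finite_bounded_tuples: "finite (bounded_tuples a b w z)"
proof (rule finite_subset)
  show "bounded_tuples a b w z \<subseteq> {xs. set xs \<subseteq> {..nat w} \<and> length xs = b}"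
  proof
    fix xs assume xs: "xs \<in> bounded_tuples a b w z"
    have "x \<le> nat w" if "x \<in> set xs" for x
    proof -
      have "x \<le> sum_list xs" using that by (simp add: member_le_sum_list)
      moreover have "int (sum_list xs) \<le> w" using xs by (simp add: bounded_tuples_def)
      ultimately show ?thesis by linarith
    qed
    with xs show "xs \<in> {xs. set xs \<subseteq> {..nat w} \<and> length xs = b}"
      by (auto simp: bounded_tuples_def)
  qed
  show "finite {xs. set xs \<subseteq> {..nat w} \<and> length xs = b}"
    by (rule finite_lists_length_eq) simp
qed

end

theory Submission
  imports Defs "HOL-Library.FuncSet"
begin

text \<open>Both sides, as functions of \<open>a\<close> and \<open>w\<close>, satisfy \<open>F (a + 1) w = F a w - F a (w - z)\<close>: the tuples
  whose entry number \<open>a\<close> violates the bound \<open>z\<close> are shifted down by \<open>z\<close> in that entry, and the sum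
  obeys the same rule by Pascal's identity.  For \<open>a = 0\<close> a slack entry turns the inequality into an
  equation, and the count is stars and bars.\<close>

lemma card_length_sum_list_le:
  "card {xs. length xs = b \<and> sum_list xs \<le> n} = (n + b) choose b"
proof -
  \<comment> \<open>The head is the slack entry \<open>n - sum_list xs\<close>; the subtraction is
    exact because \<open>sum_list xs \<le> n\<close>.\<close>
  have "bij_betw tl {l. length l = Suc b \<and> sum_list l = n}
          {xs. length xs = b \<and> sum_list xs \<le> n}"
    by (rule bij_betwI[where g = "\<lambda>xs. (n - sum_list xs) # xs"])
      (auto simp: length_Suc_conv)
  then have "card {xs. length xs = b \<and> sum_list xs \<le> n} =
      card {l. length l = Suc b \<and> sum_list l = n}"
    by (simp add: bij_betw_same_card)
  also have "\<dots> = (n + b) choose n"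
    using card_length_sum_list[of "Suc b" n] by simp
  also have "\<dots> = (n + b) choose b"
    using binomial_symmetric[of n "n + b"] by simp
  finally show ?thesis .
qed

lemma card_bounded_tuples_0: "int (card (bounded_tuples 0 b w z)) = binom (w + int b) b"
proof (cases "w < 0")
  case True
  \<comment> \<open>Here \<open>w + int b < int b\<close>, so \<open>binom\<close> vanishes too,
    even for \<open>b = 0\<close>.\<close>
  then have "bounded_tuples 0 b w z = {}"
    by (auto simp: bounded_tuples_def)
  with True show ?thesis by (simp add: binom_def)
next
  case False
  then obtain n where n: "w = int n"
    by (metis nonneg_int_cases not_less)
  then have "bounded_tuples 0 b w z = {xs. length xs = b \<and> sum_list xs \<le> n}"
    by (auto simp: bounded_tuples_def)
  with n show ?thesis
    by (simp add: binom_def card_length_sum_list_le flip: of_nat_add)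
qed

lemma card_bounded_tuples_Suc:
  assumes "a < b" and "0 \<le> z"
  shows "int (card (bounded_tuples (Suc a) b w z)) =
    int (card (bounded_tuples a b w z)) - int (card (bounded_tuples a b (w - z) z))"
proof -
  obtain n where n: "z = int n"
    using \<open>0 \<le> z\<close> by (metis nonneg_int_cases)
  let ?A = "bounded_tuples a b w z" and ?S = "bounded_tuples (Suc a) b w z"
  let ?B = "bounded_tuples a b (w - z) z"
  have sub: "?S \<subseteq> ?A"
    by (auto simp: bounded_tuples_def)
  \<comment> \<open>\<open>?A - ?S\<close> holds the tuples of \<open>?A\<close> whose entry
    \<open>a\<close> is at least \<open>n\<close>. Adding \<open>n\<close> there raises the total by
    \<open>z\<close>, the gap between the two weight bounds, and leaves the entries before
    \<open>a\<close> alone.\<close>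
  have "bij_betw (\<lambda>xs. xs[a := xs ! a + n]) ?B (?A - ?S)"
  proof (rule bij_betwI[where g = "\<lambda>xs. xs[a := xs ! a - n]"])
    show "(\<lambda>xs. xs[a := xs ! a + n]) \<in> ?B \<rightarrow> ?A - ?S"
      using \<open>a < b\<close> n
      by (auto simp: bounded_tuples_def sum_list_update member_le_sum_list less_Suc_eq)
    show "(\<lambda>xs. xs[a := xs ! a - n]) \<in> ?A - ?S \<rightarrow> ?B"
    proof
      fix xs assume xs: "xs \<in> ?A - ?S"
      then have len: "length xs = b" and "n \<le> xs ! a"
        using n by (auto simp: bounded_tuples_def less_Suc_eq)
      \<comment> \<open>\<open>sum_list_update\<close> subtracts the old entry from the sum in the
        naturals; this bound keeps that subtraction exact.\<close>
      moreover have "xs ! a \<le> sum_list xs"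
        using len \<open>a < b\<close> by (simp add: member_le_sum_list)
      ultimately show "xs[a := xs ! a - n] \<in> ?B"
        using xs n \<open>a < b\<close> by (auto simp: bounded_tuples_def sum_list_update)
    qed
    show "(xs[a := xs ! a + n])[a := (xs[a := xs ! a + n]) ! a - n] = xs" if "xs \<in> ?B" for xs
      using that \<open>a < b\<close> by (simp add: bounded_tuples_def)
    show "(xs[a := xs ! a - n])[a := (xs[a := xs ! a - n]) ! a + n] = xs" if "xs \<in> ?A - ?S" for xs
      using that \<open>a < b\<close> n by (auto simp: bounded_tuples_def less_Suc_eq)
  qed
  then have "card ?B = card (?A - ?S)"
    by (rule bij_betw_same_card)
  also have "\<dots> = card ?A - card ?S"
    using sub by (simp add: card_Diff_subset finite_bounded_tuples)
  finally show ?thesis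
    using card_mono[OF finite_bounded_tuples sub] by simp
qed

lemma alternating_binomial_sum_Suc:
  fixes g :: "nat \<Rightarrow> 'a::comm_ring_1"
  shows "(\<Sum>i\<le>Suc n. (-1) ^ i * of_nat (Suc n choose i) * g i) =
    (\<Sum>i\<le>n. (-1) ^ i * of_nat (n choose i) * g i) -
    (\<Sum>i\<le>n. (-1) ^ i * of_nat (n choose i) * g (Suc i))"
proof -
  \<comment> \<open>The added term \<open>i = Suc n\<close> has coefficient zero. With equal ranges,
    splitting off \<open>i = 0\<close> on both sides allows Pascal's rule termwise.\<close>
  have "(\<Sum>i\<le>n. (-1) ^ i * of_nat (n choose i) * g i) =
      (\<Sum>i\<le>Suc n. (-1) ^ i * of_nat (n choose i) * g i)"
    by (simp add: binomial_eq_0)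
  also have "\<dots> = g 0 - (\<Sum>i\<le>n. (-1) ^ i * of_nat (n choose Suc i) * g (Suc i))"
    by (subst sum.atMost_Suc_shift) (simp add: sum_negf)
  finally show ?thesis
    by (subst sum.atMost_Suc_shift) (simp add: sum_negf sum.distrib sum_subtractf algebra_simps)
qed

text \<open>If \<open>a > 0\<close> and \<open>z < 0\<close>, no tuple qualifies, yet the sum can be
  nonzero: \<open>a = b = 1\<close>, \<open>w = 0\<close>, \<open>z = -1\<close> gives
  \<open>1 - 2 = -1\<close>. Hence the condition on \<open>z\<close>.\<close>

theorem lemma2p5:
  fixes a b :: nat and w z :: int
  assumes "a \<le> b"
    and "a = 0 \<or> 0 \<le> z"
  shows "int (card (bounded_tuples a b w z)) =
    (\<Sum>i=0..a. (-1) ^ i * int (a choose i) * binom (w - int i * z + int b) b)"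
  using assms
proof (induction a arbitrary: w)
  case 0
  then show ?case by (simp add: card_bounded_tuples_0)
next
  case (Suc a)
  \<comment> \<open>The induction hypothesis at \<open>w - z\<close> yields the sum with
    \<open>i\<close> replaced by \<open>Suc i\<close>, which is the second sum of the alternating
    recurrence.\<close>
  have shift: "w - z - int i * z = w - int (Suc i) * z" for i
    by (simp add: algebra_simps)
  from Suc show ?case
    using alternating_binomial_sum_Suc[of a "\<lambda>i. binom (w - int i * z + int b) b"]
    by (simp only: card_bounded_tuples_Suc Suc_le_eq less_imp_le shift atMost_atLeast0 simp_thms
        nat.distinct of_nat_id)
qed

end
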